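(* Let $m\ge2$ be an integer and let $f\colon\mathbb{T}_m\to\mathbb{R}$ be a bounded function, with convex envelope $u_f^*$ and coincidence set $CS(f)=\{x\in\mathbb{T}_m: f(x)=u_f^*(x)\}$. For $v\colon\mathbb{T}_m\to\mathbb{R}$ and $x\in\mathbb{T}_m$ write $$\mathcal{M}[v](x)=\min\left\{\min_{\substack{y,z\in\mathcal{S}(x)\\ y\neq z}}\frac{v(y)+v(z)}{2}\;;\;\min_{y\in\mathcal{S}(x)}\frac{v(\hat{x})+m\,v(y)}{m+1}\right\},$$ where for $x=\emptyset$ only the first minimum is taken. Then: (i) $u_f^*$ is the solution to the obstacle problem for the equation $u=\mathcal{M}[u]$, that is, $u_f^*$ is the largest function $u\colon\mathbb{T}_m\to\mathbb{R}$ such that $u(x)\le\mathcal{M}[u](x)$ and $u(x)\le f(x)$ for all $x\in\mathbb{T}_m$ (it satisfies both conditions, and every $u$ satisfying both conditions satisfies $u\le u_f^*$ on $\mathbb{T}_m$); (ii) $f(x)\le\mathcal{M}[f](x)$ for all $x\in CS(f)$; (iii) $u_f^*(x)=\mathcal{M}[u_f^*](x)$ for all $x\in\mathbb{T}_m\setminus CS(f)$.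
   Context: Tree. For an integer $m\ge2$, $\mathbb{T}_m$ is the infinite $m$-branching tree whose vertices are the root $\emptyset$ and all finite sequences $(a_1,\dots,a_k)$, $k\ge1$, with $a_i\in\{0,\dots,m-1\}$. The level of $x=(a_1,\dots,a_k)$ is $|x|=k$, and $|\emptyset|=0$. The successors of $x$ are $\mathcal{S}(x)=\{(x,i): i\in\{0,\dots,m-1\}\}$. If $x\ne\emptyset$, $\hat{x}$ denotes its unique immediate predecessor; vertices are adjacent exactly to their successors and predecessor. Distance. The edge $(\hat{x},x)$ has length $m^{-|x|}$. For vertices $x,y$, $[x,y]$ is the unique minimal path (path with all vertices different) from $x$ to $y$, and $d(x,y)$ is the sum of the lengths of its edges. Convexity. $u\colon\mathbb{T}_m\to\mathbb{R}$ is convex if for all $x\ne y$ in $\mathbb{T}_m$ and all $z\in[x,y]$, $u(z)\le\frac{d(y,z)}{d(x,y)}u(x)+\frac{d(x,z)}{d(x,y)}u(y)$. Convex envelope of a function on the tree. For $f\colon\mathbb{T}_m\to\mathbb{R}$, $u_f^*(x)=\sup\{u(x): u\colon\mathbb{T}_m\to\mathbb{R}\text{ convex and }u\le f\text{ on }\mathbb{T}_m\}$. *)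

theory Defs
  imports "HOL-Analysis.Analysis"
begin

text \<open>
  A vertex \<open>(a\<^sub>1, \<dots>, a\<^sub>k)\<close> of the \<open>m\<close>-branching tree is the list \<open>[a\<^sub>1, \<dots>, a\<^sub>k]\<close> with entries below \<open>m\<close>,
  the root is \<open>[]\<close>, and the level of a vertex is its length. A function on the tree is a total
  function on lists of naturals of which only the values on \<open>tree m\<close> are ever used.
\<close>

definition tree :: "nat \<Rightarrow> nat list set" where
  "tree m = lists {..<m}"

definition successors :: "nat \<Rightarrow> nat list \<Rightarrow> nat list set" where
  "successors m x = {x @ [i] | i. i < m}"

text \<open>Only meaningful for \<open>x \<noteq> []\<close>.\<close>

definition predecessor :: "nat list \<Rightarrow> nat list" where
  "predecessor x = butlast x"

definition adjacent :: "nat \<Rightarrow> nat list \<Rightarrow> nat list \<Rightarrow> bool" where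
  "adjacent m x y \<longleftrightarrow> y \<in> successors m x \<or> x \<in> successors m y"

definition is_path :: "nat \<Rightarrow> nat list \<Rightarrow> nat list list \<Rightarrow> nat list \<Rightarrow> bool" where
  "is_path m x p y \<longleftrightarrow> p \<noteq> [] \<and> hd p = x \<and> last p = y \<and> set p \<subseteq> tree m \<and>
     distinct p \<and> successively (adjacent m) p"

text \<open>The minimal path \<open>[x, y]\<close>, as the list of its vertices.\<close>

definition path_between :: "nat \<Rightarrow> nat list \<Rightarrow> nat list \<Rightarrow> nat list list" where
  "path_between m x y = (THE p. is_path m x p y)"

text \<open>
  The edge between a vertex \<open>x\<close> and its predecessor has length \<open>1 / m ^ length x\<close>; the maximum of the
  levels makes this independent of the direction in which the edge is traversed.
\<close>

definition edge_length :: "nat \<Rightarrow> nat list \<Rightarrow> nat list \<Rightarrow> real" where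
  "edge_length m x y = 1 / real m ^ max (length x) (length y)"

definition path_length :: "nat \<Rightarrow> nat list list \<Rightarrow> real" where
  "path_length m p = (\<Sum>i<length p - 1. edge_length m (p ! i) (p ! Suc i))"

definition tree_dist :: "nat \<Rightarrow> nat list \<Rightarrow> nat list \<Rightarrow> real" where
  "tree_dist m x y = path_length m (path_between m x y)"

definition tree_convex :: "nat \<Rightarrow> (nat list \<Rightarrow> real) \<Rightarrow> bool" where
  "tree_convex m u \<longleftrightarrow>
     (\<forall>x\<in>tree m. \<forall>y\<in>tree m. x \<noteq> y \<longrightarrow>
        (\<forall>z\<in>set (path_between m x y).
           u z \<le> tree_dist m y z / tree_dist m x y * u x + tree_dist m x z / tree_dist m x y * u y))"

text \<open>
  For \<open>f\<close> bounded below on the tree and \<open>x\<close> in the tree, the set is nonempty and bounded above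
  by \<open>f x\<close>, so that the real supremum is the intended one.
\<close>

definition convex_envelope :: "nat \<Rightarrow> (nat list \<Rightarrow> real) \<Rightarrow> nat list \<Rightarrow> real" where
  "convex_envelope m f x = Sup {u x | u. tree_convex m u \<and> (\<forall>y\<in>tree m. u y \<le> f y)}"

definition coincidence_set :: "nat \<Rightarrow> (nat list \<Rightarrow> real) \<Rightarrow> nat list set" where
  "coincidence_set m f = {x \<in> tree m. f x = convex_envelope m f x}"

definition min_op :: "nat \<Rightarrow> (nat list \<Rightarrow> real) \<Rightarrow> nat list \<Rightarrow> real" where
  "min_op m v x =
     (let a = Min {(v y + v z) / 2 | y z. y \<in> successors m x \<and> z \<in> successors m x \<and> y \<noteq> z}
      in if x = [] then a
         else min a (Min {(v (predecessor x) + real m * v y) / (real m + 1) | y. y \<in> successors m x}))"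

end

theory Submission
  imports Defs "HOL-Library.Sublist"
begin

text \<open>
  The heart of the matter is that convexity is a local property: \<open>u\<close> is convex exactly when
  \<open>u \<le> min_op m u\<close> on the tree (\<open>tree_convex_iff_le_min_op\<close>). The averages in \<open>min_op\<close> are the
  convexity inequalities for the two-edge paths centred at \<open>x\<close>, so convex functions satisfy them.
  Conversely, along a simple path those inequalities say that the slopes of \<open>u\<close> over consecutive
  edges increase, and increasing slopes give the convexity inequality between the end points
  (\<open>monotone_slopes_imp_convex\<close>). To move between the two descriptions one has to know that
  \<open>path_between\<close> really is a path and that its initial and final segments are again the minimal
  paths; this is uniqueness of simple paths, which holds because the edge above a vertex \<open>w\<close> is the
  only edge joining the vertices below \<open>w\<close> to the others (\<open>walk_crossing\<close>).

  Granted this, the envelope is a pointwise supremum of functions lying below their own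
  \<open>min_op\<close>. As \<open>min_op\<close> is monotone, the envelope has the same property, is therefore the largest
  such function below \<open>f\<close>, and on the coincidence set \<open>f\<close> inherits the inequality. Off the
  coincidence set, if the inequality were strict at \<open>x\<close>, the value of the envelope could be raised at
  \<open>x\<close> alone: \<open>min_op\<close> at \<open>x\<close> does not see the value at \<open>x\<close>, and elsewhere it can only grow. The raised
  function would contradict maximality.
\<close>

section \<open>Uniqueness and existence of simple paths\<close>

lemma adjacent_iff: "adjacent m a b \<longleftrightarrow> (\<exists>i<m. b = a @ [i] \<or> a = b @ [i])"
  by (auto simp: adjacent_def successors_def)

lemma adjacent_sym: "adjacent m a b \<longleftrightarrow> adjacent m b a"
  by (auto simp: adjacent_iff)

text \<open>
  The vertices below \<open>w\<close> are the extensions of \<open>w\<close>. A single edge, from \<open>butlast w\<close> to \<open>w\<close>, links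
  them to the rest of the tree, so a walk that changes sides visits both of its ends.
\<close>

lemma walk_crossing:
  assumes "successively (adjacent m) p" "p \<noteq> []" "prefix w (hd p) \<noteq> prefix w (last p)"
  shows "w \<in> set p \<and> butlast w \<in> set p"
  using assms
proof (induction p rule: induct_list012)
  case (3 a b p)
  show ?case
  proof (cases "prefix w a = prefix w b")
    case True
    then show ?thesis using 3 by auto
  next
    case False
    have "adjacent m a b" using 3 by simp
    then have "(a = w \<and> b = butlast w) \<or> (b = w \<and> a = butlast w)"
      using False by (auto simp: adjacent_iff)
    then show ?thesis by auto
  qed
qed auto

text \<open>
  The first step of a simple path is dictated by its end point: a downward step can only be
  taken towards the end point, and an upward one only if the end point is not below the start,
  since otherwise the path would have to come back through its start.
\<close>

lemma path_first_step:
  assumes "successively (adjacent m) (a # b # p)" "distinct (a # b # p)"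
  shows "(\<exists>i. b = a @ [i] \<and> prefix b (last (b # p))) \<or>
         (b = butlast a \<and> \<not> prefix a (last (b # p)))"
proof -
  have walk: "successively (adjacent m) (b # p)" and notin: "a \<notin> set (b # p)"
    using assms by auto
  obtain i where "b = a @ [i] \<or> a = b @ [i]"
    using assms by (auto simp: adjacent_iff)
  then show ?thesis
  proof
    assume b: "b = a @ [i]"
    then have "prefix b (last (b # p))"
      using walk_crossing[OF walk, of b] notin
      by (cases "prefix b (last (b # p))") (simp_all del: last.simps)
    then show ?thesis using b by blast
  next
    assume a: "a = b @ [i]"
    have "\<not> prefix a b" using a by (auto dest: prefix_length_le)
    then have "\<not> prefix a (last (b # p))"
      using walk_crossing[OF walk, of a] notin by auto
    then show ?thesis using a by simp
  qed
qed

lemma is_path_unique: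
  assumes "is_path m x p y" "is_path m x q y"
  shows "p = q"
  using assms
proof (induction p arbitrary: x q rule: induct_list012)
  case 1
  then show ?case by (simp add: is_path_def)
next
  case (2 a)
  then have "q \<noteq> []" "hd q = a" "last q = a" "distinct q"
    by (auto simp: is_path_def)
  then show ?case by (cases q) (auto split: if_splits)
next
  case (3 a b p)
  obtain c q' where q: "q = a # c # q'"
  proof -
    have "q \<noteq> []" "hd q = a" "last q = last (b # p)" "a \<notin> set (b # p)"
      using 3(3,4) by (auto simp: is_path_def)
    moreover from this have "tl q \<noteq> []"
      by (metis last.simps last_in_set list.collapse list.distinct(1))
    ultimately show ?thesis using that by (metis list.collapse)
  qed
  have y: "last (b # p) = y" "last (c # q') = y"
    using 3(3,4) q by (auto simp: is_path_def)
  have "b = c"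
  proof -
    have b: "(\<exists>i. b = a @ [i] \<and> prefix b y) \<or> (b = butlast a \<and> \<not> prefix a y)"
      using path_first_step[of m a b p] 3(3) y by (auto simp: is_path_def)
    have c: "(\<exists>i. c = a @ [i] \<and> prefix c y) \<or> (c = butlast a \<and> \<not> prefix a y)"
      using path_first_step[of m a c q'] 3(4) y q by (auto simp: is_path_def)
    show ?thesis using b c by (auto simp: prefix_def)
  qed
  moreover have "is_path m b (b # p) y" "is_path m c (c # q') y"
    using 3(3,4) q by (auto simp: is_path_def split: if_splits)
  ultimately show ?case using 3(2) q by blast
qed

lemma path_between_eq:
  assumes "is_path m x p y"
  shows "path_between m x y = p"
  unfolding path_between_def using assms is_path_unique by blast

lemma successor_in_tree: "x \<in> tree m \<Longrightarrow> y \<in> successors m x \<Longrightarrow> y \<in> tree m"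
  by (auto simp: tree_def successors_def)

lemma predecessor_in_tree: "x \<in> tree m \<Longrightarrow> predecessor x \<in> tree m"
  by (auto simp: tree_def predecessor_def lists_eq_set dest: in_set_butlastD)

lemma is_path_suffix:
  assumes "is_path m x (xs @ z # ys) y"
  shows "is_path m z (z # ys) y"
  using assms by (auto simp: is_path_def successively_append_iff split: if_splits)

lemma is_path_prefix:
  assumes "is_path m x (xs @ z # ys) y"
  shows "is_path m x (xs @ [z]) z"
proof -
  have "successively (adjacent m) ((xs @ [z]) @ ys)"
    using assms by (simp add: is_path_def)
  then have "successively (adjacent m) (xs @ [z])"
    unfolding successively_append_iff by blast
  then show ?thesis using assms by (cases xs) (auto simp: is_path_def)
qed

lemma is_path_rev:
  assumes "is_path m x p y"
  shows "is_path m y (rev p) x"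
  using assms by (auto simp: is_path_def hd_rev last_rev adjacent_sym)

lemma is_path_exists:
  assumes "x \<in> tree m" "y \<in> tree m"
  shows "\<exists>p. is_path m x p y"
proof -
  define R where "R a b \<longleftrightarrow> a \<in> tree m \<and> b \<in> tree m \<and> adjacent m a b" for a b
  have root: "R\<^sup>*\<^sup>* [] z" if "z \<in> tree m" for z
    using that
  proof (induction z rule: rev_induct)
    case (snoc i z)
    then have "R z (z @ [i])" by (auto simp: R_def tree_def adjacent_iff)
    moreover have "R\<^sup>*\<^sup>* [] z" using snoc by (simp add: tree_def)
    ultimately show ?case by (rule rtranclp.rtrancl_into_rtrancl[rotated])
  qed simp
  have "symp R" by (auto simp: symp_def R_def adjacent_sym)
  then have "R\<^sup>*\<^sup>* x []" using root[OF assms(1)] by (blast dest: sympD[OF symp_rtranclp])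
  then have "R\<^sup>*\<^sup>* x y" using root[OF assms(2)] by (rule rtranclp_trans)
  then show ?thesis
  proof (induction rule: converse_rtranclp_induct)
    case base
    show ?case using assms by (intro exI[of _ "[y]"]) (simp add: is_path_def)
  next
    case (step a b)
    then obtain p where p: "is_path m b p y" by blast
    show ?case
    proof (cases "a \<in> set p")
      case True
      \<comment> \<open>The walk would return to \<open>a\<close>, so the loop is cut off.\<close>
      then obtain xs ys where "p = xs @ a # ys" by (meson split_list)
      then show ?thesis using is_path_suffix p by blast
    next
      case False
      then have "is_path m a (a # p) y"
        using p step by (cases p) (auto simp: is_path_def R_def)
      then show ?thesis by blast
    qed
  qed
qed

section \<open>Distances along paths\<close>

lemma tree_dist_eq: "is_path m x p y \<Longrightarrow> tree_dist m x y = path_length m p"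
  by (simp add: tree_dist_def path_between_eq)

lemma edge_length_sym: "edge_length m a b = edge_length m b a"
  by (simp add: edge_length_def max.commute)

lemma edge_length_pos: "m > 0 \<Longrightarrow> edge_length m a b > 0"
  by (simp add: edge_length_def)

lemma path_length_rev: "path_length m (rev p) = path_length m p"
proof -
  let ?n = "length p - 1"
  have "path_length m (rev p) = (\<Sum>i<?n. edge_length m (p ! (?n - Suc i)) (p ! Suc (?n - Suc i)))"
    unfolding path_length_def
    by (rule sum.cong) (auto simp: rev_nth edge_length_sym Suc_diff_Suc)
  also have "\<dots> = path_length m p"
    unfolding path_length_def
    by (rule sum.nat_diff_reindex[of "\<lambda>i. edge_length m (p ! i) (p ! Suc i)"])
  finally show ?thesis .
qed

lemma tree_dist_rev:
  assumes "is_path m x p y"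
  shows "tree_dist m y x = path_length m p"
  using tree_dist_eq[OF is_path_rev[OF assms]] by (simp add: path_length_rev)

lemma path_length_prefix:
  "path_length m (xs @ [z]) =
     (\<Sum>k<length xs. edge_length m ((xs @ z # ys) ! k) ((xs @ z # ys) ! Suc k))"
  unfolding path_length_def
  by (rule sum.cong) (auto simp: nth_append less_Suc_eq not_less le_Suc_eq)

lemma path_length_suffix:
  "path_length m (z # ys) =
     (\<Sum>k=length xs..<length xs + length ys.
        edge_length m ((xs @ z # ys) ! k) ((xs @ z # ys) ! Suc k))"
  unfolding path_length_def
  by (rule sum.reindex_bij_witness[of _ "\<lambda>k. k - length xs" "\<lambda>k. k + length xs"])
     (auto simp: nth_append)

section \<open>Convexity is a local property\<close>

text \<open>
  The inequality for two-edge paths, on which both descriptions of convexity meet: the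
  denominators are cleared and both orientations of the path are covered at once.
\<close>

definition locally_convex_at :: "nat \<Rightarrow> (nat list \<Rightarrow> real) \<Rightarrow> nat list \<Rightarrow> bool" where
  "locally_convex_at m u b \<longleftrightarrow>
     (\<forall>a\<in>tree m. \<forall>c\<in>tree m. adjacent m a b \<and> adjacent m b c \<and> a \<noteq> c \<longrightarrow>
        (edge_length m a b + edge_length m b c) * u b
          \<le> edge_length m b c * u a + edge_length m a b * u c)"

lemma tree_convex_imp_locally_convex_at:
  assumes "m > 0" "tree_convex m u" "b \<in> tree m"
  shows "locally_convex_at m u b"
  unfolding locally_convex_at_def
proof (intro ballI impI, elim conjE)
  fix a c assume ac: "a \<in> tree m" "c \<in> tree m" "adjacent m a b" "adjacent m b c" "a \<noteq> c"
  let ?e = "edge_length m a b" and ?f = "edge_length m b c"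
  have "a \<noteq> b" "b \<noteq> c" using ac by (auto simp: adjacent_iff)
  then have p: "is_path m a ([a] @ b # [c]) c"
    using ac assms by (auto simp: is_path_def)
  have d: "tree_dist m a c = ?e + ?f" "tree_dist m a b = ?e" "tree_dist m c b = ?f"
    using tree_dist_eq[OF p] tree_dist_eq[OF is_path_prefix[OF p]]
      tree_dist_rev[OF is_path_suffix[OF p]]
    by (auto simp: path_length_def numeral_2_eq_2)
  have "b \<in> set (path_between m a c)" using path_between_eq[OF p] by simp
  then have "u b \<le> ?f / (?e + ?f) * u a + ?e / (?e + ?f) * u c"
    using assms(2) ac d unfolding tree_convex_def by metis
  also have "\<dots> = (?f * u a + ?e * u c) / (?e + ?f)"
    by (simp add: add_divide_distrib)
  finally show "(?e + ?f) * u b \<le> ?f * u a + ?e * u c"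
    using edge_length_pos[OF assms(1)] by (simp add: pos_le_divide_eq add_pos_pos mult.commute)
qed

text \<open>
  A piecewise linear function with nodes \<open>v 0, \<dots>, v n\<close> and increasing slopes lies below its
  chord: for \<open>i < n\<close>, the slope \<open>s i\<close> just after node \<open>i\<close> bounds the slopes before \<open>i\<close> from above and
  those after \<open>i\<close> from below.
\<close>

lemma monotone_slopes_imp_convex:
  fixes w v :: "nat \<Rightarrow> real"
  assumes pos: "\<And>k. k < n \<Longrightarrow> w k > 0"
    and step: "\<And>k. Suc k < n \<Longrightarrow>
      (v (Suc k) - v k) / w k \<le> (v (Suc (Suc k)) - v (Suc k)) / w (Suc k)"
    and i: "i \<le> n"
  shows "(\<Sum>k<n. w k) * v i \<le> (\<Sum>k=i..<n. w k) * v 0 + (\<Sum>k<i. w k) * v n"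
proof (cases "i = n")
  case False
  define s where "s k = (v (Suc k) - v k) / w k" for k
  have mono: "s j \<le> s k" if "j \<le> k" "k < n" for j k
    using that
  proof (induction k rule: dec_induct)
    case (step k)
    then show ?case using assms(2)[of k] by (force simp: s_def)
  qed simp
  have incr: "v (Suc k) - v k = s k * w k" if "k < n" for k
    using pos[OF that] by (simp add: s_def)
  let ?A = "\<Sum>k<i. w k" and ?B = "\<Sum>k=i..<n. w k"
  have "v i - v 0 = (\<Sum>k<i. v (Suc k) - v k)" by (simp add: sum_lessThan_telescope)
  also have "\<dots> \<le> (\<Sum>k<i. s i * w k)"
    using i False by (intro sum_mono) (simp add: incr mult_right_mono mono less_imp_le[OF pos])
  finally have 1: "v i - v 0 \<le> s i * ?A" by (simp add: sum_distrib_left)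
  have "s i * ?B = (\<Sum>k=i..<n. s i * w k)" by (simp add: sum_distrib_left)
  also have "\<dots> \<le> (\<Sum>k=i..<n. v (Suc k) - v k)"
    using i False by (intro sum_mono) (simp add: incr mult_right_mono mono less_imp_le[OF pos])
  also have "\<dots> = v n - v i" using i by (simp add: sum_Suc_diff')
  finally have 2: "s i * ?B \<le> v n - v i" .
  have "?A \<ge> 0" "?B \<ge> 0" using i by (auto intro!: sum_nonneg less_imp_le[OF pos])
  then have "?B * (v i - v 0) \<le> ?B * (s i * ?A)" "?A * (s i * ?B) \<le> ?A * (v n - v i)"
    using 1 2 by (auto intro: mult_left_mono)
  moreover have "(\<Sum>k<n. w k) = ?A + ?B"
    using i by (metis atLeast0LessThan sum.atLeastLessThan_concat zero_le)
  ultimately show ?thesis by (simp add: algebra_simps)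
qed simp

lemma locally_convex_imp_tree_convex:
  assumes m: "m > 0" and loc: "\<And>b. b \<in> tree m \<Longrightarrow> locally_convex_at m u b"
  shows "tree_convex m u"
  unfolding tree_convex_def
proof (intro ballI impI)
  fix x y z assume xy: "x \<in> tree m" "y \<in> tree m" "x \<noteq> y" and "z \<in> set (path_between m x y)"
  moreover obtain p where p: "is_path m x p y" using is_path_exists xy by blast
  ultimately have "z \<in> set p" by (simp add: path_between_eq)
  then obtain xs ys where pxy: "p = xs @ z # ys" by (meson split_list)
  define n where "n = length xs + length ys"
  define w where "w k = edge_length m (p ! k) (p ! Suc k)" for k
  define v where "v k = u (p ! k)" for k
  have len: "length p = Suc n" by (simp add: pxy n_def)
  have pos: "w k > 0" for k using edge_length_pos[OF m] by (simp add: w_def)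
  have slopes: "(v (Suc k) - v k) / w k \<le> (v (Suc (Suc k)) - v (Suc k)) / w (Suc k)"
    if "Suc k < n" for k
  proof -
    have "p ! k \<in> tree m" "p ! Suc k \<in> tree m" "p ! Suc (Suc k) \<in> tree m"
      using p that len by (auto simp: is_path_def)
    moreover have "adjacent m (p ! k) (p ! Suc k)" "adjacent m (p ! Suc k) (p ! Suc (Suc k))"
      using p that len by (auto simp: is_path_def successively_conv_nth)
    moreover have "p ! k \<noteq> p ! Suc (Suc k)"
      using p that len by (simp add: is_path_def nth_eq_iff_index_eq)
    ultimately have "(w k + w (Suc k)) * v (Suc k) \<le> w (Suc k) * v k + w k * v (Suc (Suc k))"
      using loc unfolding locally_convex_at_def w_def v_def by blast
    then show ?thesis using pos[of k] pos[of "Suc k"] by (simp add: field_simps)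
  qed
  have dist: "tree_dist m x z = (\<Sum>k<length xs. w k)" "tree_dist m y z = (\<Sum>k=length xs..<n. w k)"
      "tree_dist m x y = (\<Sum>k<n. w k)"
    using tree_dist_eq[OF is_path_prefix[OF p[unfolded pxy]]]
      tree_dist_rev[OF is_path_suffix[OF p[unfolded pxy]]] tree_dist_eq[OF p] len
    by (simp_all add: path_length_prefix[of m xs z ys] path_length_suffix[of m z ys xs]
        w_def pxy n_def path_length_def[of m "xs @ z # ys"])
  have "hd p = x" "last p = y" "p \<noteq> []" using p by (auto simp: is_path_def)
  then have ends: "v 0 = u x" "v n = u y" "v (length xs) = u z"
    using len pxy by (auto simp: v_def hd_conv_nth last_conv_nth nth_append)
  have "n > 0"
    using len \<open>hd p = x\<close> \<open>last p = y\<close> xy(3) by (cases p) auto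
  then have D: "(\<Sum>k<n. w k) > 0" using pos by (intro sum_pos) auto
  have "(\<Sum>k<n. w k) * u z \<le> tree_dist m y z * u x + tree_dist m x z * u y"
    using monotone_slopes_imp_convex[of n w v "length xs", OF pos slopes]
    unfolding dist ends by (simp add: n_def)
  then have "u z \<le> (tree_dist m y z * u x + tree_dist m x z * u y) / (\<Sum>k<n. w k)"
    using D by (simp add: pos_le_divide_eq mult.commute)
  then show "u z \<le> tree_dist m y z / tree_dist m x y * u x + tree_dist m x z / tree_dist m x y * u y"
    by (simp add: dist(3) add_divide_distrib)
qed

section \<open>The operator as a system of inequalities\<close>

text \<open>
  Comparing with an arbitrary \<open>c\<close> instead of \<open>v x\<close> determines the value of the operator completely.
  Its monotonicity, and its indifference to the value of \<open>v\<close> at \<open>x\<close>, can then be read off without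
  handling the minima again.
\<close>

lemma le_min_op_iff:
  assumes "m \<ge> 2"
  shows "c \<le> min_op m v x \<longleftrightarrow>
     (\<forall>y\<in>successors m x. \<forall>z\<in>successors m x. y \<noteq> z \<longrightarrow> c \<le> (v y + v z) / 2) \<and>
     (x \<noteq> [] \<longrightarrow>
        (\<forall>y\<in>successors m x. c \<le> (v (predecessor x) + real m * v y) / (real m + 1)))"
proof -
  let ?S = "successors m x"
  let ?A = "{(v y + v z) / 2 | y z. y \<in> ?S \<and> z \<in> ?S \<and> y \<noteq> z}"
  let ?B = "{(v (predecessor x) + real m * v y) / (real m + 1) | y. y \<in> ?S}"
  have S: "?S = (\<lambda>i. x @ [i]) ` {..<m}" by (auto simp: successors_def)
  then have fin: "finite ?S" by simp
  have "?A = (\<Union>y\<in>?S. (\<lambda>z. (v y + v z) / 2) ` (?S - {y}))" by (intro set_eqI) blast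
  then have finA: "finite ?A" using fin by simp
  have finB: "finite ?B" using fin by simp
  have 01: "x @ [0] \<in> ?S" "x @ [1] \<in> ?S" "x @ [0] \<noteq> x @ [1]" using assms by (auto simp: successors_def)
  then have neA: "?A \<noteq> {}" by blast
  have neB: "?B \<noteq> {}" using 01(1) by blast
  have "c \<le> Min ?A \<longleftrightarrow> (\<forall>y\<in>?S. \<forall>z\<in>?S. y \<noteq> z \<longrightarrow> c \<le> (v y + v z) / 2)"
    unfolding Min_ge_iff[OF finA neA] by blast
  moreover have "c \<le> Min ?B \<longleftrightarrow>
      (\<forall>y\<in>?S. c \<le> (v (predecessor x) + real m * v y) / (real m + 1))"
    unfolding Min_ge_iff[OF finB neB] by blast
  ultimately show ?thesis by (cases "x = []") (simp_all add: min_op_def Let_def)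
qed

lemma min_op_mono:
  assumes "m \<ge> 2" "x \<in> tree m" "\<And>y. y \<in> tree m \<Longrightarrow> v y \<le> v' y"
  shows "min_op m v x \<le> min_op m v' x"
proof -
  have le: "min_op m v x \<le> min_op m v x" ..
  have "(v y + v z) / 2 \<le> (v' y + v' z) / 2" if "y \<in> successors m x" "z \<in> successors m x" for y z
    using assms(3)[OF successor_in_tree[OF assms(2) that(1)]]
      assms(3)[OF successor_in_tree[OF assms(2) that(2)]] by simp
  moreover have "(v (predecessor x) + real m * v y) / (real m + 1)
      \<le> (v' (predecessor x) + real m * v' y) / (real m + 1)" if "y \<in> successors m x" for y
    using assms(3)[OF successor_in_tree[OF assms(2) that]]
      assms(3)[OF predecessor_in_tree[OF assms(2)]]
    by (intro divide_right_mono add_mono mult_left_mono) auto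
  ultimately show ?thesis
    using le unfolding le_min_op_iff[OF assms(1)] by (meson order_trans)
qed

lemma edge_length_successor:
  assumes "y \<in> successors m x"
  shows "edge_length m x y = 1 / real m ^ Suc (length x)"
  using assms by (auto simp: successors_def edge_length_def)

lemma convex_ineq_equal_weights:
  fixes e :: real
  assumes "e > 0"
  shows "(e + e) * b \<le> e * a + e * c \<longleftrightarrow> b \<le> (a + c) / 2"
proof -
  have "(e + e) * b \<le> e * a + e * c \<longleftrightarrow> e * (2 * b) \<le> e * (a + c)" by (simp add: algebra_simps)
  then show ?thesis using assms by (auto simp: mult_le_cancel_left_pos)
qed

lemma convex_ineq_ratio_weights:
  fixes e m :: real
  assumes "e > 0" "m > 0"
  shows "(m * e + e) * b \<le> e * a + m * e * c \<longleftrightarrow> b \<le> (a + m * c) / (m + 1)"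
proof -
  have "(m * e + e) * b \<le> e * a + m * e * c \<longleftrightarrow> e * (b * (m + 1)) \<le> e * (a + m * c)"
    by (simp add: algebra_simps)
  then show ?thesis using assms by (simp add: mult_le_cancel_left_pos pos_le_divide_eq)
qed

text \<open>
  Two distinct neighbours of \<open>b\<close> are either two successors, at equal distance from \<open>b\<close>, or the
  predecessor and a successor, at distances in the ratio of \<open>m\<close> to one. These are the two
  families of averages in the operator.
\<close>

lemma locally_convex_at_iff_le_min_op:
  assumes m: "m \<ge> 2" and b: "b \<in> tree m"
  shows "locally_convex_at m u b \<longleftrightarrow> u b \<le> min_op m u b"
proof -
  let ?e = "1 / real m ^ Suc (length b)"
  let ?ineq = "\<lambda>a c. (edge_length m a b + edge_length m b c) * u b
          \<le> edge_length m b c * u a + edge_length m a b * u c"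
  have e: "?e > 0" using m by simp
  have siblings: "?ineq y z \<longleftrightarrow> u b \<le> (u y + u z) / 2"
    if "y \<in> successors m b" "z \<in> successors m b" for y z
    using convex_ineq_equal_weights[OF e, of "u b" "u y" "u z"]
    by (simp only: edge_length_successor[OF that(1)] edge_length_successor[OF that(2)]
        edge_length_sym[of m y b])
  have through: "?ineq (predecessor b) y \<longleftrightarrow> u b \<le> (u (predecessor b) + real m * u y) / (real m + 1)"
    if "b \<noteq> []" "y \<in> successors m b" for y
  proof -
    have "edge_length m (predecessor b) b = real m * ?e"
      using that(1) m by (auto simp: edge_length_def predecessor_def)
    then show ?thesis
      using convex_ineq_ratio_weights[OF e, of "real m" "u b" "u (predecessor b)" "u y"] m
      by (simp add: edge_length_successor[OF that(2)] del: power_Suc)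
  qed
  have sym: "?ineq a c \<longleftrightarrow> ?ineq c a" for a c
    by (simp only: edge_length_sym[of m a b] edge_length_sym[of m c b] add.commute)
  have nbr: "adjacent m a b \<longleftrightarrow> a \<in> successors m b \<or> (b \<noteq> [] \<and> a = predecessor b)"
    if "a \<in> tree m" for a
    using b by (cases b rule: rev_cases)
      (auto simp: adjacent_iff successors_def predecessor_def tree_def)
  have pred: "y \<noteq> predecessor b" if "y \<in> successors m b" for y
    using that by (auto simp: successors_def predecessor_def dest: arg_cong[of _ _ length])
  have "locally_convex_at m u b \<longleftrightarrow>
     (\<forall>y\<in>successors m b. \<forall>z\<in>successors m b. y \<noteq> z \<longrightarrow> ?ineq y z) \<and>
     (b \<noteq> [] \<longrightarrow> (\<forall>y\<in>successors m b. ?ineq (predecessor b) y))" (is "_ \<longleftrightarrow> ?R")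
  proof
    assume L: "locally_convex_at m u b"
    have L': "?ineq a c"
      if "a \<in> tree m" "c \<in> tree m" "adjacent m a b" "adjacent m c b" "a \<noteq> c" for a c
      using L that adjacent_sym[of m b c] unfolding locally_convex_at_def by blast
    have succ: "y \<in> tree m \<and> adjacent m y b" if "y \<in> successors m b" for y
      using successor_in_tree[OF b that] nbr that by blast
    have "predecessor b \<in> tree m \<and> adjacent m (predecessor b) b" if "b \<noteq> []"
      using predecessor_in_tree[OF b] nbr that by blast
    then show ?R using L' succ pred by (intro conjI ballI impI) blast+
  next
    assume R: ?R
    show "locally_convex_at m u b"
      unfolding locally_convex_at_def
    proof (intro ballI impI, elim conjE)
      fix a c assume "a \<in> tree m" "c \<in> tree m" "adjacent m a b" "adjacent m b c" "a \<noteq> c"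
      then have "a \<in> successors m b \<or> b \<noteq> [] \<and> a = predecessor b"
        "c \<in> successors m b \<or> b \<noteq> [] \<and> c = predecessor b"
        using nbr adjacent_sym by blast+
      then show "?ineq a c" using R sym \<open>a \<noteq> c\<close> by blast
    qed
  qed
  also have "\<dots> \<longleftrightarrow> u b \<le> min_op m u b"
    unfolding le_min_op_iff[OF m] using siblings through by blast
  finally show ?thesis .
qed

theorem tree_convex_iff_le_min_op:
  assumes "m \<ge> 2"
  shows "tree_convex m u \<longleftrightarrow> (\<forall>x\<in>tree m. u x \<le> min_op m u x)"
  using assms tree_convex_imp_locally_convex_at[of m u] locally_convex_imp_tree_convex[of m u]
    locally_convex_at_iff_le_min_op[OF assms] by auto

section \<open>The convex envelope\<close>

lemma convex_envelope_upper:
  assumes "tree_convex m u" "\<forall>y\<in>tree m. u y \<le> f y" "x \<in> tree m"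
  shows "u x \<le> convex_envelope m f x"
  unfolding convex_envelope_def
  by (rule cSup_upper) (use assms in \<open>auto intro!: bdd_aboveI[of _ "f x"]\<close>)

text \<open>A lower bound of \<open>f\<close>, as a constant function, makes the supremum one over a nonempty set.\<close>

lemma convex_envelope_least:
  assumes "m \<ge> 2" "bounded (f ` tree m)"
    and "\<And>u. tree_convex m u \<Longrightarrow> \<forall>y\<in>tree m. u y \<le> f y \<Longrightarrow> u x \<le> c"
  shows "convex_envelope m f x \<le> c"
proof -
  obtain l where l: "\<forall>y\<in>tree m. l \<le> f y"
    using bounded_imp_bdd_below[OF assms(2)] by (auto simp: bdd_below_def)
  have "(\<lambda>_. l) y \<le> min_op m (\<lambda>_. l) y" for y
    unfolding le_min_op_iff[OF assms(1)] by (simp add: field_simps)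
  then have "tree_convex m (\<lambda>_. l)" using tree_convex_iff_le_min_op[OF assms(1)] by blast
  then have "{u x | u. tree_convex m u \<and> (\<forall>y\<in>tree m. u y \<le> f y)} \<noteq> {}" using l by blast
  then show ?thesis
    unfolding convex_envelope_def by (rule cSup_least) (use assms(3) in auto)
qed

lemma convex_envelope_le:
  assumes "m \<ge> 2" "bounded (f ` tree m)" "x \<in> tree m"
  shows "convex_envelope m f x \<le> f x"
  using convex_envelope_least[OF assms(1,2)] assms(3) by blast

lemma convex_envelope_le_min_op:
  assumes "m \<ge> 2" "bounded (f ` tree m)" "x \<in> tree m"
  shows "convex_envelope m f x \<le> min_op m (convex_envelope m f) x"
proof (rule convex_envelope_least[OF assms(1,2)])
  fix u assume u: "tree_convex m u" "\<forall>y\<in>tree m. u y \<le> f y"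
  have "u x \<le> min_op m u x" using tree_convex_iff_le_min_op[OF assms(1)] u assms(3) by blast
  also have "\<dots> \<le> min_op m (convex_envelope m f) x"
    using min_op_mono[OF assms(1,3)] convex_envelope_upper[OF u] by blast
  finally show "u x \<le> min_op m (convex_envelope m f) x" .
qed

lemma convex_envelope_greatest:
  assumes "m \<ge> 2" "\<forall>x\<in>tree m. u x \<le> min_op m u x \<and> u x \<le> f x" "x \<in> tree m"
  shows "u x \<le> convex_envelope m f x"
  using convex_envelope_upper assms tree_convex_iff_le_min_op[OF assms(1)] by blast

lemma min_op_fun_upd:
  assumes "m \<ge> 2"
  shows "min_op m (v(x := c)) x = min_op m v x"
proof -
  have "y \<noteq> x" if "y \<in> successors m x" for y
    using that by (auto simp: successors_def)
  moreover have "predecessor x \<noteq> x" if "x \<noteq> []"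
    using that by (cases x rule: rev_cases) (auto simp: predecessor_def)
  ultimately have "d \<le> min_op m (v(x := c)) x \<longleftrightarrow> d \<le> min_op m v x" for d
    unfolding le_min_op_iff[OF assms] by simp
  then show ?thesis by (meson order_antisym order_refl)
qed

text \<open>
  Raising the envelope at \<open>x\<close> alone, as far as \<open>f\<close> and the operator permit, keeps it admissible;
  maximality says that there is no room for raising.
\<close>

lemma convex_envelope_eq_min_op:
  assumes m: "m \<ge> 2" and f: "bounded (f ` tree m)" and x: "x \<in> tree m"
    and strict: "convex_envelope m f x < f x"
  shows "convex_envelope m f x = min_op m (convex_envelope m f) x"
proof -
  let ?E = "convex_envelope m f"
  define c where "c = min (f x) (min_op m ?E x)"
  define u where "u = ?E(x := c)"
  have "?E x \<le> c"
    using convex_envelope_le_min_op[OF m f x] strict by (simp add: c_def)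
  then have "?E y \<le> u y" for y by (simp add: u_def)
  then have above: "min_op m ?E y \<le> min_op m u y" if "y \<in> tree m" for y
    using min_op_mono[OF m that] by blast
  have "u y \<le> min_op m u y \<and> u y \<le> f y" if y: "y \<in> tree m" for y
  proof (cases "y = x")
    case True
    then show ?thesis using min_op_fun_upd[OF m, of ?E x c] by (simp add: u_def c_def)
  next
    case False
    then show ?thesis
      using above[OF y] convex_envelope_le_min_op[OF m f y] convex_envelope_le[OF m f y]
      by (simp add: u_def)
  qed
  then have "u x \<le> ?E x" using convex_envelope_greatest[OF m _ x] by blast
  then have "min_op m ?E x \<le> ?E x" using strict by (simp add: u_def c_def min_def split: if_splits)
  then show ?thesis using convex_envelope_le_min_op[OF m f x] by simp
qed

theorem theorem1p3:
  fixes m :: nat and f :: "nat list \<Rightarrow> real"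
  assumes "m \<ge> 2"
    and "bounded (f ` tree m)"
  shows "((\<forall>x\<in>tree m. convex_envelope m f x \<le> min_op m (convex_envelope m f) x
              \<and> convex_envelope m f x \<le> f x)
          \<and> (\<forall>u :: nat list \<Rightarrow> real.
                (\<forall>x\<in>tree m. u x \<le> min_op m u x \<and> u x \<le> f x) \<longrightarrow>
                (\<forall>x\<in>tree m. u x \<le> convex_envelope m f x)))
       \<and> (\<forall>x\<in>coincidence_set m f. f x \<le> min_op m f x)
       \<and> (\<forall>x\<in>tree m - coincidence_set m f.
             convex_envelope m f x = min_op m (convex_envelope m f) x)"
proof (intro conjI ballI allI impI)
  fix x assume "x \<in> coincidence_set m f"
  then have x: "x \<in> tree m" and eq: "f x = convex_envelope m f x"
    by (auto simp: coincidence_set_def)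
  have "f x \<le> min_op m (convex_envelope m f) x"
    using convex_envelope_le_min_op[OF assms x] eq by simp
  also have "\<dots> \<le> min_op m f x"
    using min_op_mono[OF assms(1) x] convex_envelope_le[OF assms] by blast
  finally show "f x \<le> min_op m f x" .
next
  fix x assume "x \<in> tree m - coincidence_set m f"
  then have x: "x \<in> tree m" and "f x \<noteq> convex_envelope m f x"
    by (auto simp: coincidence_set_def)
  then have "convex_envelope m f x < f x"
    using convex_envelope_le[OF assms x] by simp
  then show "convex_envelope m f x = min_op m (convex_envelope m f) x"
    by (rule convex_envelope_eq_min_op[OF assms x])
qed (use assms convex_envelope_le_min_op convex_envelope_le convex_envelope_greatest in blast)+

end
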